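(* Let $I\subseteq\mathbb{R}$ be an interval with interior $I^{\circ}$, let $f:I\to\mathbb{R}$ be differentiable on $I^{\circ}$ and such that $f'\in L[a,b]$, where $a,b\in I$ with $a<b$. Suppose $|f'|^{q}$ is concave on $[a,b]$ for some fixed $q>1$. Then for every division $d: a=x_0<x_1<\dots<x_{n-1}<x_n=b$ of $[a,b]$, the trapezoidal error satisfies $$|E(f,d)|\le\left(\frac{q-1}{2q-1}\right)^{\frac{q-1}{q}}\sum_{i=0}^{n-1}\frac{(x_{i+1}-x_i)^2}{4}\left(\left|f'\left(\frac{3x_i+x_{i+1}}{4}\right)\right|+\left|f'\left(\frac{x_i+3x_{i+1}}{4}\right)\right|\right).$$
   Context: $f'\in L[a,b]$ means that $f'$ is (Lebesgue) integrable on $[a,b]$. For a division $d: a=x_0<x_1<\dots<x_n=b$, the trapezoidal sum is $T(f,d)=\sum_{i=0}^{n-1}\frac{f(x_i)+f(x_{i+1})}{2}(x_{i+1}-x_i)$, and the error $E(f,d)$ is defined by $\int_a^b f(x)\,dx=T(f,d)+E(f,d)$.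
   Formalization: If a or b is an endpoint of I, f is also assumed to have a one-sided derivative there, whose value is f' in the concavity condition; with differentiability only on the interior, f could jump at a or b and the bound would fail. *)

theory Defs
  imports "HOL-Analysis.Analysis"
begin

text \<open>The points \<open>x 0, \<dots>, x n\<close> of a division are the values on \<open>{..n}\<close> of a sequence; values
  beyond \<open>n\<close> play no role.\<close>

definition is_partition :: "real \<Rightarrow> real \<Rightarrow> nat \<Rightarrow> (nat \<Rightarrow> real) \<Rightarrow> bool" where
  "is_partition a b n x \<longleftrightarrow> x 0 = a \<and> x n = b \<and> (\<forall>i<n. x i < x (Suc i))"

definition trapezoidal_sum :: "(real \<Rightarrow> real) \<Rightarrow> nat \<Rightarrow> (nat \<Rightarrow> real) \<Rightarrow> real" where
  "trapezoidal_sum f n x = (\<Sum>i<n. (f (x i) + f (x (Suc i))) / 2 * (x (Suc i) - x i))"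

definition trapezoidal_error :: "(real \<Rightarrow> real) \<Rightarrow> nat \<Rightarrow> (nat \<Rightarrow> real) \<Rightarrow> real" where
  "trapezoidal_error f n x = integral {x 0..x n} f - trapezoidal_sum f n x"

end

theory Submission
  imports Defs
begin

text \<open>
  On a cell with midpoint \<open>m\<close>, integration by parts gives the error as \<open>- \<integral> (t - m) f'(t) dt\<close>. Both halves
  of the cell are treated by Hoelder's inequality with \<open>p = q / (q - 1)\<close> and by Hadamard's inequality
  for the concave \<open>\<bar>f'\<bar>\<^sup>q\<close>. The two are merged: after normalisation, Young's inequality and the tangent
  line of \<open>\<bar>f'\<bar>\<^sup>q\<close> at the centre of the half bound the integrand pointwise by an explicit function.
\<close>

section \<open>Supporting lines of concave functions and elementary integrals\<close>

lemma concave_on_tangent_line: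
  fixes g :: "real \<Rightarrow> real"
  assumes "concave_on S g" and "c \<in> interior S"
  obtains s where "\<And>t. t \<in> S \<Longrightarrow> g t \<le> g c + s * (t - c)"
proof -
  \<comment> \<open>\<open>r\<close> is the right derivative of the convex function
    \<open>- g\<close> at \<open>c\<close>, an infimum of difference quotients; it exists even where
    \<open>g\<close> has a corner.\<close>
  define r where "r = Inf ((\<lambda>t. (- g c - - g t) / (c - t)) ` ({c<..} \<inter> S))"
  have "convex_on S (\<lambda>t. - g t)"
    using assms(1) by (simp add: concave_on_def)
  from convex_le_Inf_differential[OF this assms(2)]
  have "g t \<le> g c + - r * (t - c)" if "t \<in> S" for t
    using that unfolding r_def by fastforce
  then show thesis by (rule that)
qed

lemma powr_affine_has_integral:
  fixes u v p :: real
  assumes "u \<le> v" and "p > 0"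
  shows "((\<lambda>t. (t - u) powr p) has_integral (v - u) powr (p + 1) / (p + 1)) {u..v}"
proof -
  have "((\<lambda>t. (t - u) powr p) has_integral
      ((v - u) powr (p + 1) / (p + 1) - (u - u) powr (p + 1) / (p + 1))) {u..v}"
  \<comment> \<open>The differentiation rule for \<open>powr\<close> asks for a positive base, so
    the derivative is taken inside the interval and \<open>u\<close> is reached by
    continuity.\<close>
  proof (rule fundamental_theorem_of_calculus_interior)
    show "continuous_on {u..v} (\<lambda>t. (t - u) powr (p + 1) / (p + 1))"
      using assms(2) by (intro continuous_intros continuous_on_powr') auto
    fix t assume "t \<in> {u<..<v}"
    then have "((\<lambda>t. (t - u) powr (p + 1) / (p + 1)) has_real_derivative (t - u) powr p) (at t)"
      using assms(2) by (auto intro!: derivative_eq_intros)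
    then show "((\<lambda>t. (t - u) powr (p + 1) / (p + 1)) has_vector_derivative (t - u) powr p) (at t)"
      by (simp add: has_real_derivative_iff_has_vector_derivative)
  qed (use assms in auto)
  then show ?thesis by simp
qed

lemma centred_has_integral:
  fixes u v :: real
  assumes "u \<le> v"
  shows "((\<lambda>t. t - (u + v) / 2) has_integral 0) {u..v}"
proof -
  have "((\<lambda>t. t - (u + v) / 2) has_integral
      ((v - (u + v) / 2)\<^sup>2 / 2 - (u - (u + v) / 2)\<^sup>2 / 2)) {u..v}"
    using assms
    by (intro fundamental_theorem_of_calculus)
      (auto intro!: derivative_eq_intros simp flip: has_real_derivative_iff_has_vector_derivative)
  moreover have "(v - (u + v) / 2)\<^sup>2 = (u - (u + v) / 2)\<^sup>2"
    by (simp add: power2_eq_square field_simps)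
  ultimately show ?thesis by simp
qed

section \<open>Errors of the endpoint rules and of the trapezoid on one cell\<close>

lemma continuous_on_of_real_derivative:
  fixes f f' :: "real \<Rightarrow> real"
  assumes "\<And>t. t \<in> S \<Longrightarrow> (f has_real_derivative f' t) (at t within S)"
  shows "continuous_on S f"
  using assms DERIV_continuous continuous_on_eq_continuous_within by blast

text \<open>Integration by parts: the gauge integral recovers \<open>(t - u) * f t\<close> from its
  derivative, and subtracting the integral of the continuous \<open>f\<close> leaves the
  claim.\<close>

lemma right_endpoint_error_has_integral:
  fixes f f' :: "real \<Rightarrow> real"
  assumes "u \<le> v"
    and der: "\<And>t. t \<in> {u..v} \<Longrightarrow> (f has_real_derivative f' t) (at t within {u..v})"
  shows "((\<lambda>t. (t - u) * f' t) has_integral ((v - u) * f v - integral {u..v} f)) {u..v}"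
proof -
  have "((\<lambda>t. f t + (t - u) * f' t) has_integral ((v - u) * f v - (u - u) * f u)) {u..v}"
    using assms
    by (intro fundamental_theorem_of_calculus)
      (auto intro!: derivative_eq_intros simp flip: has_real_derivative_iff_has_vector_derivative)
  moreover have "(f has_integral integral {u..v} f) {u..v}"
    using continuous_on_of_real_derivative[OF der]
    by (simp add: integrable_continuous_real integrable_integral)
  ultimately have "((\<lambda>t. f t + (t - u) * f' t - f t) has_integral
      ((v - u) * f v - (u - u) * f u - integral {u..v} f)) {u..v}"
    by (rule has_integral_diff)
  then show ?thesis by simp
qed

text \<open>With \<open>p = q / (q - 1)\<close> the constant is
  \<open>(1 / (p + 1)) powr (1 / p)\<close>. The factors \<open>t - u\<close> and \<open>f'\<close>
  are divided by \<open>W\<close> and \<open>A\<close>, chosen so that the two terms of Young's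
  inequality have means at most \<open>1 / p\<close> and \<open>1 / q\<close>, which add up to 1.
  Only an explicit majorant has to be integrated.\<close>

lemma right_endpoint_error_bound:
  fixes f f' :: "real \<Rightarrow> real"
  assumes "u < v" and q: "q > 1"
    and der: "\<And>t. t \<in> {u..v} \<Longrightarrow> (f has_real_derivative f' t) (at t within {u..v})"
    and conc: "concave_on {u..v} (\<lambda>t. \<bar>f' t\<bar> powr q)"
  shows "\<bar>(v - u) * f v - integral {u..v} f\<bar> \<le>
    ((q - 1) / (2 * q - 1)) powr ((q - 1) / q) * (v - u)\<^sup>2 * \<bar>f' ((u + v) / 2)\<bar>"
proof -
  define c where "c = (u + v) / 2"
  define A where "A = \<bar>f' c\<bar>"
  define L where "L = v - u"
  define p where "p = q / (q - 1)"
  define K where "K = ((q - 1) / (2 * q - 1)) powr ((q - 1) / q)"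
  \<comment> \<open>\<open>W\<close> is the p-th power mean of \<open>t - u\<close> over the
    interval: \<open>W powr p = L powr p / (p + 1)\<close>.\<close>
  define W where "W = L * K"
  have L: "L > 0" using assms(1) by (simp add: L_def)
  have p: "p > 1" using q by (simp add: p_def field_simps)
  have pq: "1 / p + 1 / q = 1" using q by (simp add: p_def field_simps)
  have K: "K > 0" using q by (simp add: K_def)
  have W: "W > 0" using L K by (simp add: W_def)
  have "K powr p = (q - 1) / (2 * q - 1)"
    using q by (simp add: K_def p_def powr_powr)
  also have "\<dots> = 1 / (p + 1)"
    using q by (simp add: p_def field_simps)
  finally have "W powr p = L powr p / (p + 1)"
    using L K by (simp add: W_def powr_mult)
  then have Wp: "L powr (p + 1) / (p + 1) / W powr p = L"
    using L p by (simp add: powr_add)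
  obtain s where s: "\<And>t. t \<in> {u..v} \<Longrightarrow> \<bar>f' t\<bar> powr q \<le> \<bar>f' c\<bar> powr q + s * (t - c)"
    using concave_on_tangent_line[OF conc, of c] assms(1)
    by (auto simp: c_def)
  have int: "((\<lambda>t. (t - u) * f' t) has_integral ((v - u) * f v - integral {u..v} f)) {u..v}"
    using assms(1) der by (intro right_endpoint_error_has_integral) auto
  have "\<bar>(v - u) * f v - integral {u..v} f\<bar> \<le> W * A * L"
  proof (cases "A = 0")
    \<comment> \<open>Division by \<open>A\<close> is impossible here. The tangent line is
      \<open>s * (t - c)\<close> and is nonnegative at both ends, on either side of
      \<open>c\<close>; so \<open>s = 0\<close> and \<open>f'\<close> vanishes.\<close>
    case True
    have ends: "0 \<le> s * (u - c)" "0 \<le> s * (v - c)"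
      using s[of u] s[of v] True assms(1) q unfolding A_def
      by (smt (verit) atLeastAtMost_iff powr_eq_0_iff powr_ge_zero)+
    then have "s = 0"
      using assms(1) by (auto simp: c_def zero_le_mult_iff)
    have "f' t = 0" if "t \<in> {u..v}" for t
    proof -
      have "\<bar>f' t\<bar> powr q \<le> 0"
        using s[OF that] True \<open>s = 0\<close> by (simp add: A_def)
      then have "\<bar>f' t\<bar> powr q = 0"
        using powr_ge_zero by (rule antisym)
      then show ?thesis by simp
    qed
    then have "((\<lambda>t. (t - u) * f' t) has_integral 0) {u..v}"
      by (intro has_integral_is_0) auto
    with int have "(v - u) * f v - integral {u..v} f = 0"
      by (rule has_integral_unique)
    then show ?thesis using True by simp
  next
    case False
    then have A: "A > 0" by (simp add: A_def)
    \<comment> \<open>Young's bound, with \<open>\<bar>f' t\<bar> powr q\<close> replaced by its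
      tangent line at \<open>c\<close> and divided by \<open>A powr q\<close>.\<close>
    define B where "B t = W * A * ((t - u) powr p / W powr p / p
      + (1 + s / A powr q * (t - c)) / q)" for t
    have bound: "\<bar>(t - u) * f' t\<bar> \<le> B t" if t: "t \<in> {u..v}" for t
    proof -
      have "\<bar>(t - u) * f' t\<bar> = W * A * ((t - u) / W * (\<bar>f' t\<bar> / A))"
        using t W A by (simp add: abs_mult)
      also have "(t - u) / W * (\<bar>f' t\<bar> / A) \<le>
          ((t - u) / W) powr p / p + (\<bar>f' t\<bar> / A) powr q / q"
        using t W A p q pq by (intro Youngs_inequality) auto
      also have "\<dots> \<le> (t - u) powr p / W powr p / p + (1 + s / A powr q * (t - c)) / q"
      proof -
        have "(\<bar>f' t\<bar> / A) powr q = \<bar>f' t\<bar> powr q / A powr q"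
          using A by (simp add: powr_divide)
        also have "\<dots> \<le> (A powr q + s * (t - c)) / A powr q"
          using s[OF t] by (intro divide_right_mono) (auto simp: A_def)
        also have "\<dots> = 1 + s / A powr q * (t - c)"
          using A by (simp add: field_simps)
        finally have "(\<bar>f' t\<bar> / A) powr q / q \<le> (1 + s / A powr q * (t - c)) / q"
          using q by (intro divide_right_mono) auto
        then show ?thesis
          using t W by (simp add: powr_divide)
      qed
      finally show ?thesis using W A by (simp add: B_def)
    qed
    \<comment> \<open>The sloped part of the tangent line integrates to 0, because \<open>c\<close>
      is the midpoint.\<close>
    have "(B has_integral W * A * (L powr (p + 1) / (p + 1) / W powr p / p
        + (L + s / A powr q * 0) / q)) {u..v}"
      unfolding B_def L_def c_def
      using assms(1) p has_integral_const_real[of "1::real" u v]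
      by (intro has_integral_mult_right has_integral_add has_integral_divide
          powr_affine_has_integral centred_has_integral) auto
    also have "W * A * (L powr (p + 1) / (p + 1) / W powr p / p + (L + s / A powr q * 0) / q)
        = W * A * (L * (1 / p + 1 / q))"
      unfolding Wp by (simp add: algebra_simps)
    also have "\<dots> = W * A * L"
      using pq by simp
    finally have "(B has_integral W * A * L) {u..v}" .
    then have "B integrable_on {u..v}" and "integral {u..v} B = W * A * L"
      by (rule has_integral_integrable, rule integral_unique)
    moreover have "norm (integral {u..v} (\<lambda>t. (t - u) * f' t)) \<le> integral {u..v} B"
      using has_integral_integrable[OF int] \<open>B integrable_on {u..v}\<close> bound
      by (intro Henstock_Kurzweil_Integration.integral_norm_bound_integral) auto
    ultimately show ?thesis
      by (simp add: integral_unique[OF int])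
  qed
  also have "W * A * L = K * L\<^sup>2 * A"
    unfolding W_def power2_eq_square by (simp only: mult_ac)
  finally show ?thesis
    unfolding K_def L_def A_def c_def .
qed

text \<open>Mirror image of the right endpoint rule under \<open>t \<mapsto> - t\<close>: the
  derivative only changes sign, and midpoints go to midpoints.\<close>

lemma left_endpoint_error_bound:
  fixes f f' :: "real \<Rightarrow> real"
  assumes "u < v" and q: "q > 1"
    and der: "\<And>t. t \<in> {u..v} \<Longrightarrow> (f has_real_derivative f' t) (at t within {u..v})"
    and conc: "concave_on {u..v} (\<lambda>t. \<bar>f' t\<bar> powr q)"
  shows "\<bar>(v - u) * f u - integral {u..v} f\<bar> \<le>
    ((q - 1) / (2 * q - 1)) powr ((q - 1) / q) * (v - u)\<^sup>2 * \<bar>f' ((u + v) / 2)\<bar>"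
proof -
  have "\<bar>(- u - - v) * f (- (- u)) - integral {- v..- u} (\<lambda>t. f (- t))\<bar> \<le>
    ((q - 1) / (2 * q - 1)) powr ((q - 1) / q) * (- u - - v)\<^sup>2 * \<bar>- f' (- ((- v + - u) / 2))\<bar>"
  proof (rule right_endpoint_error_bound[where f = "\<lambda>t. f (- t)" and f' = "\<lambda>t. - f' (- t)"])
    fix t assume "t \<in> {- v..- u}"
    then have "(f has_real_derivative f' (- t)) (at (- t) within uminus ` {- v..- u})"
      using der[of "- t"] by auto
    from DERIV_image_chain[OF this DERIV_minus[OF DERIV_ident]]
    show "((\<lambda>t. f (- t)) has_real_derivative - f' (- t)) (at t within {- v..- u})"
      by (simp add: o_def)
  next
    \<comment> \<open>Reflection is linear, so it keeps the weights of convex combinations and with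
      them concavity.\<close>
    have "\<bar>f' (- ((1 - r) *\<^sub>R x + r *\<^sub>R y))\<bar> powr q \<ge> (1 - r) * \<bar>f' (- x)\<bar> powr q + r * \<bar>f' (- y)\<bar> powr q"
      if "0 \<le> r" "r \<le> 1" "x \<in> {- v..- u}" "y \<in> {- v..- u}" for r x y
      using concave_onD[OF conc, of r "- x" "- y"] that by auto
    then have "concave_on {- v..- u} (\<lambda>t. \<bar>f' (- t)\<bar> powr q)"
      unfolding concave_on_iff by (smt (verit) convex_real_interval(5))
    then show "concave_on {- v..- u} (\<lambda>t. \<bar>- f' (- t)\<bar> powr q)"
      by simp
  qed (use assms in auto)
  moreover have "- ((- v - u) / 2) = (u + v) / 2" by argo
  moreover have "integral {- v..- u} (\<lambda>t. f (- t)) = integral {u..v} f"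
    by (rule Henstock_Kurzweil_Integration.integral_reflect_real)
  ultimately show ?thesis by simp
qed

text \<open>The trapezoid is the left endpoint rule on the left half plus the right endpoint rule on
  the right half. The midpoints of the halves are the quarter points, and the squared half length
  gives the factor 1/4.\<close>

lemma trapezoid_cell_error_bound:
  fixes f f' :: "real \<Rightarrow> real"
  assumes "u < v" and "q > 1"
    and der: "\<And>t. t \<in> {u..v} \<Longrightarrow> (f has_real_derivative f' t) (at t within {u..v})"
    and conc: "concave_on {u..v} (\<lambda>t. \<bar>f' t\<bar> powr q)"
  shows "\<bar>integral {u..v} f - (f u + f v) / 2 * (v - u)\<bar> \<le>
    ((q - 1) / (2 * q - 1)) powr ((q - 1) / q) *
    ((v - u)\<^sup>2 / 4 * (\<bar>f' ((3 * u + v) / 4)\<bar> + \<bar>f' ((u + 3 * v) / 4)\<bar>))"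
proof -
  define m where "m = (u + v) / 2"
  define K where "K = ((q - 1) / (2 * q - 1)) powr ((q - 1) / q)"
  have m: "u < m" "m < v" using assms(1) by (auto simp: m_def)
  have der': "(f has_real_derivative f' t) (at t within S)" if "t \<in> S" "S \<subseteq> {u..v}" for t S
    using der that by (blast intro: DERIV_subset)
  have conc': "concave_on S (\<lambda>t. \<bar>f' t\<bar> powr q)" if "S \<subseteq> {u..v}" "convex S" for S
    using conc that by (auto simp: concave_on_def intro: convex_on_subset)
  have left: "\<bar>(m - u) * f u - integral {u..m} f\<bar> \<le> K * (m - u)\<^sup>2 * \<bar>f' ((u + m) / 2)\<bar>"
    unfolding K_def using m assms(2)
    by (intro left_endpoint_error_bound der' conc') auto
  have right: "\<bar>(v - m) * f v - integral {m..v} f\<bar> \<le> K * (v - m)\<^sup>2 * \<bar>f' ((m + v) / 2)\<bar>"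
    unfolding K_def using m assms(2)
    by (intro right_endpoint_error_bound der' conc') auto
  have split: "integral {u..v} f = integral {u..m} f + integral {m..v} f"
    using m continuous_on_of_real_derivative[OF der]
    by (simp add: Henstock_Kurzweil_Integration.integral_combine integrable_continuous_real)
  have halves: "m - u = (v - u) / 2" "v - m = (v - u) / 2"
    "(u + m) / 2 = (3 * u + v) / 4" "(m + v) / 2 = (u + 3 * v) / 4"
    by (auto simp: m_def field_simps)
  \<comment> \<open>The endpoint errors are rule minus integral, the opposite sign to the
    trapezoidal error; the absolute value absorbs this.\<close>
  have "\<bar>integral {u..v} f - (f u + f v) / 2 * (v - u)\<bar> =
      \<bar>((m - u) * f u - integral {u..m} f) + ((v - m) * f v - integral {m..v} f)\<bar>"
    unfolding split halves by argo
  also have "\<dots> \<le> K * (m - u)\<^sup>2 * \<bar>f' ((u + m) / 2)\<bar> + K * (v - m)\<^sup>2 * \<bar>f' ((m + v) / 2)\<bar>"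
    using left right by linarith
  also have "\<dots> = K * ((v - u)\<^sup>2 / 4 * (\<bar>f' ((3 * u + v) / 4)\<bar> + \<bar>f' ((u + 3 * v) / 4)\<bar>))"
    unfolding halves by (simp add: power_divide algebra_simps)
  finally show ?thesis by (simp add: K_def)
qed

section \<open>Summation over the cells of a division\<close>

lemma is_partition_mono:
  assumes "is_partition a b n x" and "i \<le> j" and "j \<le> n"
  shows "x i \<le> x j"
  using assms(2,3)
proof (induction j rule: dec_induct)
  case (step k)
  then have "x k < x (Suc k)" using assms(1) by (auto simp: is_partition_def)
  with step show ?case by auto
qed simp

lemma integral_partition:
  fixes f :: "real \<Rightarrow> real"
  assumes "is_partition a b n x" and "f integrable_on {a..b}" and "k \<le> n"
  shows "integral {x 0..x k} f = (\<Sum>i<k. integral {x i..x (Suc i)} f)"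
  \<comment> \<open>The induction runs over initial segments \<open>k \<le> n\<close>, with the
    division itself fixed.\<close>
  using assms(3)
proof (induction k)
  case (Suc k)
  note mono = is_partition_mono[OF assms(1)]
  have "{x 0..x (Suc k)} \<subseteq> {a..b}"
    using mono[of "Suc k" n] Suc.prems assms(1) by (auto simp: is_partition_def)
  then have "f integrable_on {x 0..x (Suc k)}"
    using assms(2) integrable_subinterval_real by blast
  then have "integral {x 0..x k} f + integral {x k..x (Suc k)} f = integral {x 0..x (Suc k)} f"
    using mono[of 0 k] mono[of k "Suc k"] Suc.prems
    by (intro Henstock_Kurzweil_Integration.integral_combine) auto
  then show ?case using Suc by simp
qed simp

theorem proposition4:
  fixes I :: "real set" and f f' :: "real \<Rightarrow> real" and a b q :: real
    and n :: nat and x :: "nat \<Rightarrow> real"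
  assumes "is_interval I" and "a \<in> I" and "b \<in> I" and "a < b"
    and "\<And>t. t \<in> interior I \<Longrightarrow> (f has_real_derivative f' t) (at t)"
    and "\<And>t. t \<in> {a..b} \<Longrightarrow> (f has_real_derivative f' t) (at t within I)"
    and "f' absolutely_integrable_on {a..b}"
    and "q > 1"
    and "concave_on {a..b} (\<lambda>t. \<bar>f' t\<bar> powr q)"
    and "is_partition a b n x"
  shows "\<bar>trapezoidal_error f n x\<bar> \<le>
    ((q - 1) / (2 * q - 1)) powr ((q - 1) / q) *
    (\<Sum>i<n. (x (Suc i) - x i)\<^sup>2 / 4 *
      (\<bar>f' ((3 * x i + x (Suc i)) / 4)\<bar> + \<bar>f' ((x i + 3 * x (Suc i)) / 4)\<bar>))"
proof -
  \<comment> \<open>This lets the derivative within \<open>I\<close> be restricted to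
    \<open>{a..b}\<close>, where it is one-sided at the ends.\<close>
  have "{a..b} \<subseteq> I"
    using assms(1-3) by (meson atLeastAtMost_iff is_interval_1 subsetI)
  then have der: "(f has_real_derivative f' t) (at t within {a..b})" if "t \<in> {a..b}" for t
    using assms(6) that by (blast intro: DERIV_subset)
  have cell: "\<bar>integral {x i..x (Suc i)} f - (f (x i) + f (x (Suc i))) / 2 * (x (Suc i) - x i)\<bar> \<le>
      ((q - 1) / (2 * q - 1)) powr ((q - 1) / q) * ((x (Suc i) - x i)\<^sup>2 / 4 *
      (\<bar>f' ((3 * x i + x (Suc i)) / 4)\<bar> + \<bar>f' ((x i + 3 * x (Suc i)) / 4)\<bar>))" if "i < n" for i
  proof (rule trapezoid_cell_error_bound)
    have sub: "{x i..x (Suc i)} \<subseteq> {a..b}"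
      using is_partition_mono[OF assms(10), of 0 i] is_partition_mono[OF assms(10), of "Suc i" n]
        that assms(10) by (auto simp: is_partition_def)
    show "(f has_real_derivative f' t) (at t within {x i..x (Suc i)})"
      if "t \<in> {x i..x (Suc i)}" for t
      using der sub that by (blast intro: DERIV_subset)
    show "concave_on {x i..x (Suc i)} (\<lambda>t. \<bar>f' t\<bar> powr q)"
      using assms(9) sub by (auto simp: concave_on_def intro: convex_on_subset)
  qed (use that assms(8,10) in \<open>auto simp: is_partition_def\<close>)
  have "f integrable_on {a..b}"
    using continuous_on_of_real_derivative[OF der] by (rule integrable_continuous_real)
  \<comment> \<open>Additivity of the integral makes the total error the sum of the cell errors, so
    the triangle inequality and the cell bound finish.\<close>
  then have "trapezoidal_error f n x = (\<Sum>i<n. integral {x i..x (Suc i)} f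
      - (f (x i) + f (x (Suc i))) / 2 * (x (Suc i) - x i))"
    unfolding trapezoidal_error_def trapezoidal_sum_def
    by (simp add: integral_partition[OF assms(10)] sum_subtractf)
  then have "\<bar>trapezoidal_error f n x\<bar> \<le> (\<Sum>i<n. \<bar>integral {x i..x (Suc i)} f
      - (f (x i) + f (x (Suc i))) / 2 * (x (Suc i) - x i)\<bar>)"
    by (simp only: sum_abs)
  also have "\<dots> \<le> (\<Sum>i<n. ((q - 1) / (2 * q - 1)) powr ((q - 1) / q) *
      ((x (Suc i) - x i)\<^sup>2 / 4 *
      (\<bar>f' ((3 * x i + x (Suc i)) / 4)\<bar> + \<bar>f' ((x i + 3 * x (Suc i)) / 4)\<bar>)))"
    by (intro sum_mono cell) simp
  finally show ?thesis
    unfolding sum_distrib_left .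
qed

end
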